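(* Let $\mathcal{R}$ be a unital ring with involution, let $m\in\mathcal{R}$ be invertible with $m^*=m$, and let $a,b\in\mathcal{R}^{\mathrm{core},m}$. The following statements are equivalent: (i) $ab,ba\in\mathcal{R}^{\mathrm{core},m}$ with $(ba)^{\mathrm{core},m}=a^{\mathrm{core},m}b^{\mathrm{core},m}$ and $(ab)^{\mathrm{core},m}=b^{\mathrm{core},m}a^{\mathrm{core},m}$; (ii) $ba\,a^{\mathrm{core},m},\,ab\,b^{\mathrm{core},m}\in\mathcal{R}^{\mathrm{core},m}$ with $\left(ab\,b^{\mathrm{core},m}\right)^{\mathrm{core},m}=b\,b^{\mathrm{core},m}a^{\mathrm{core},m}$ and $\left(ba\,a^{\mathrm{core},m}\right)^{\mathrm{core},m}=a\,a^{\mathrm{core},m}b^{\mathrm{core},m}$, and moreover $ba\,\mathcal{R}=(ba)^2\mathcal{R}$ and $ab\,\mathcal{R}=(ab)^2\mathcal{R}$.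
   Context: $\mathcal{R}$ is a (not necessarily commutative) unital ring with an involution $x\mapsto x^*$ satisfying $(xy)^*=y^*x^*$, $(x+y)^*=x^*+y^*$, $(x^* )^*=x$. For an invertible $m\in\mathcal{R}$ with $m^*=m$, an element $z\in\mathcal{R}$ is the $m$-weighted core inverse of $a\in\mathcal{R}$ if $aza=a$, $z\mathcal{R}=a\mathcal{R}$ and $\mathcal{R}z=\mathcal{R}a^*m$. It is unique if it exists and is denoted $a^{\mathrm{core},m}$; $\mathcal{R}^{\mathrm{core},m}$ is the set of elements that have an $m$-weighted core inverse. *)

theory Defs
  imports Main
begin

(* ring + monoid_mult rather than ring_1: the zero ring (0 = 1) is not excluded. *)
class involutive_ring = ring + monoid_mult +
  fixes star :: "'a \<Rightarrow> 'a"
  assumes star_mult: "star (x * y) = star y * star x"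
    and star_add: "star (x + y) = star x + star y"
    and star_star: "star (star x) = x"

definition right_ideal_of :: "'a::times \<Rightarrow> 'a set"
  where "right_ideal_of x = {x * r | r. True}"

definition left_ideal_of :: "'a::times \<Rightarrow> 'a set"
  where "left_ideal_of x = {r * x | r. True}"

(* The predicate "unit" of the library, x dvd 1, is meant for commutative rings. *)
definition two_sided_invertible :: "'a::monoid_mult \<Rightarrow> bool"
  where "two_sided_invertible x \<longleftrightarrow> (\<exists>y. x * y = 1 \<and> y * x = 1)"

definition is_weighted_core_inverse :: "'a::involutive_ring \<Rightarrow> 'a \<Rightarrow> 'a \<Rightarrow> bool"
  where "is_weighted_core_inverse m a z \<longleftrightarrow>
    a * z * a = a \<and>
    right_ideal_of z = right_ideal_of a \<and>
    left_ideal_of z = left_ideal_of (star a * m)"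

definition weighted_core_invertibles :: "'a::involutive_ring \<Rightarrow> 'a set"
  where "weighted_core_invertibles m = {a. \<exists>z. is_weighted_core_inverse m a z}"

(* Meaningful only for a in weighted_core_invertibles m with m invertible and
   self-adjoint; see weighted_core_inverse_unique. *)
definition weighted_core_inverse :: "'a::involutive_ring \<Rightarrow> 'a \<Rightarrow> 'a"
  where "weighted_core_inverse m a = (THE z. is_weighted_core_inverse m a z)"

lemma is_weighted_core_inverse_props:
  assumes inv: "two_sided_invertible m" and sa: "star m = m"
    and z: "is_weighted_core_inverse m a z"
  shows "z * a * z = z" "z * a * a = a" "a * z * z = z" "star (m * a * z) = m * a * z"
proof -
  have aza: "a * z * a = a"
    and R: "right_ideal_of z = right_ideal_of a"
    and L: "left_ideal_of z = left_ideal_of (star a * m)"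
    using z by (auto simp: is_weighted_core_inverse_def)
  obtain n where n: "m * n = 1" "n * m = 1"
    using inv by (auto simp: two_sided_invertible_def)
  have "z \<in> right_ideal_of z" "a \<in> right_ideal_of a" "z \<in> left_ideal_of z"
    unfolding right_ideal_of_def left_ideal_of_def
    by (auto intro: exI[of _ 1] simp del: mult_1_left mult_1_right)
       (metis mult_1_right mult_1_left)+
  then obtain u w y where u: "z = a * u" and w: "a = z * w" and y: "z = y * (star a * m)"
    using R L unfolding right_ideal_of_def left_ideal_of_def by blast
  have sa': "star a = star a * star (a * z)"
    by (metis aza star_mult)
  have "z = y * (star a * star (a * z) * m)"
    using y sa' by simp
  also have "\<dots> = y * (star a * (m * n) * star (a * z) * m)"
    by (simp add: n)
  also have "\<dots> = (y * (star a * m)) * n * star (a * z) * m"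
    by (simp only: mult.assoc)
  finally have z1: "z = z * n * star (a * z) * m"
    using y by simp
  define p where "p = m * a * z"
  have p: "star p = star (a * z) * m"
    by (simp add: p_def mult.assoc star_mult sa)
  have pp: "p = p * n * star p"
    unfolding p using z1 by (metis p_def mult.assoc)
  have "star n * m = 1"
  proof -
    have "star 1 = (1::'a)" by (metis mult_1_left mult_1_right star_mult star_star)
    then show ?thesis using n sa by (metis star_mult)
  qed
  then have "star n = n"
    using n by (metis mult.assoc mult_1_left mult_1_right)
  then have h: "star p = p"
    using pp by (metis star_mult star_star mult.assoc)
  then show "star (m * a * z) = m * a * z"
    by (simp add: p_def)
  have "z = z * n * p"
    using z1 h p by (simp add: mult.assoc)
  also have "\<dots> = z * (n * m) * a * z"
    by (simp only: p_def mult.assoc)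
  finally show zaz: "z * a * z = z"
    by (simp add: n)
  show "z * a * a = a" using w zaz by (metis mult.assoc)
  show "a * z * z = z" using u aza by (metis mult.assoc)
qed

lemma weighted_core_inverse_unique:
  assumes inv: "two_sided_invertible m" and sa: "star m = m"
    and z: "is_weighted_core_inverse m a z" and y: "is_weighted_core_inverse m a y"
  shows "z = y"
proof -
  note Z = is_weighted_core_inverse_props[OF inv sa z]
  note Y = is_weighted_core_inverse_props[OF inv sa y]
  have aza: "a * z * a = a" and aya: "a * y * a = a"
    using z y by (auto simp: is_weighted_core_inverse_def)
  obtain n where n: "n * m = 1"
    using inv by (auto simp: two_sided_invertible_def)
  have "m * a * y = star (m * a * y)"
    using Y by simp
  also have "\<dots> = star (m * (a * z * a) * y)"
    by (simp add: aza)
  also have "\<dots> = star (m * a * z * (a * y))"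
    by (simp only: mult.assoc)
  also have "\<dots> = star (a * y) * (m * a * z)"
    by (simp only: star_mult[of "m * a * z"] Z)
  also have "\<dots> = star (m * a * y) * a * z"
    by (simp only: star_mult mult.assoc sa)
  also have "\<dots> = m * a * y * a * z"
    by (simp only: Y)
  also have "\<dots> = m * (a * y * a) * z"
    by (simp only: mult.assoc)
  finally have "m * a * y = m * a * z"
    by (simp only: aya)
  then have "n * m * (a * y) = n * m * (a * z)"
    by (simp only: mult.assoc)
  then have ayz: "a * y = a * z"
    by (simp add: n)
  have "y = z * a * a * y * y"
    using Y Z by simp
  also have "\<dots> = z * a * (a * y * y)"
    by (simp only: mult.assoc)
  also have "\<dots> = z * (a * y)"
    using Y by (simp add: mult.assoc)
  also have "\<dots> = z"
    using Z by (simp add: ayz flip: mult.assoc)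
  finally show ?thesis ..
qed

end

theory Submission imports Defs begin

text \<open>
  Write \<open>x\<close>, \<open>y\<close> for the weighted core inverses of \<open>a\<close>, \<open>b\<close>. Then \<open>p = a x\<close> and \<open>q = b y\<close> are
  idempotents, self-adjoint for the weighted adjoint \<open>c \<mapsto> m\<^sup>-\<^sup>1 c\<^sup>* m\<close>, with ranges \<open>a\<R>\<close> and \<open>b\<R>\<close>.
  The two conditions concern the same projections, because
  \<open>(b a) (x y) = b p y = (b p) (p y)\<close> and \<open>(a b) (y x) = a q x = (a q) (q x)\<close>.
  Call these products \<open>e\<close> and \<open>f\<close>. Most of the axioms therefore pass from one condition to the
  other at once, and what has to be compared is ranges: \<open>x y \<R> = b a \<R>\<close> against
  \<open>p y \<R> = b p \<R>\<close>.

  The key is that each condition forces \<open>p\<close> and \<open>q\<close> to commute and \<open>e = f = p q\<close>. On either side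
  one shows that \<open>q x\<close> equals \<open>e x\<close> or \<open>f x\<close>. As \<open>x a\<close> acts as the identity on \<open>a\<R>\<close>, multiplication
  by \<open>a p\<close> on the right turns this into \<open>q p = e\<close> or \<open>q p = f\<close>. So \<open>q p\<close> is self-adjoint, which for
  self-adjoint \<open>p\<close>, \<open>q\<close> means that they commute; exchanging \<open>a\<close> and \<open>b\<close> gives the other projection.

  Once \<open>e = f\<close>, the right ideals \<open>a b \<R>\<close> and \<open>b a \<R>\<close> both equal \<open>e\<R>\<close>, and the first condition
  implies the second. For the converse, \<open>a\<close> and \<open>b\<close> map \<open>e\<R>\<close> into itself. The hypothesis
  \<open>a b \<R> = (a b)\<^sup>2 \<R>\<close> makes \<open>a\<close> map \<open>e\<R>\<close> onto itself, hence \<open>x\<close> does so too, and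
  \<open>x y \<R> = x e \<R> = e \<R> = b a \<R>\<close>.
\<close>

section \<open>Weighted self-adjoint elements and core inverses\<close>

lemma right_ideal_of_eq_iff:
  fixes c z :: "'a::monoid_mult"
  shows "right_ideal_of c = right_ideal_of z \<longleftrightarrow> (\<exists>u. c = z * u) \<and> (\<exists>w. z = c * w)"
proof
  assume eq: "right_ideal_of c = right_ideal_of z"
  have "c \<in> right_ideal_of c" "z \<in> right_ideal_of z"
    unfolding right_ideal_of_def by (metis (mono_tags, lifting) CollectI mult_1_right)+
  then show "(\<exists>u. c = z * u) \<and> (\<exists>w. z = c * w)"
    using eq unfolding right_ideal_of_def by blast
next
  assume "(\<exists>u. c = z * u) \<and> (\<exists>w. z = c * w)"
  then obtain u w where "c = z * u" "z = c * w" by blast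
  then show "right_ideal_of c = right_ideal_of z"
    unfolding right_ideal_of_def by (metis mult.assoc)
qed

text \<open>
  For invertible self-adjoint \<open>m\<close>, the map \<open>c \<mapsto> m\<^sup>-\<^sup>1 c\<^sup>* m\<close> is again an involution; these are its
  fixed points, written without \<open>m\<^sup>-\<^sup>1\<close>.
\<close>

definition weighted_selfadjoint :: "'a::involutive_ring \<Rightarrow> 'a \<Rightarrow> bool"
  where "weighted_selfadjoint m p \<longleftrightarrow> star (m * p) = m * p"

context
  fixes m :: "'a::involutive_ring"
  assumes inv: "two_sided_invertible m" and sa: "star m = m"
begin

text \<open>The weighted adjoint of \<open>q p\<close> is \<open>p q\<close>.\<close>

lemma weighted_selfadjoint_commute:
  assumes "weighted_selfadjoint m p" "weighted_selfadjoint m q" "weighted_selfadjoint m (q * p)"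
  shows "p * q = q * p"
proof -
  obtain n where n: "n * m = 1"
    using inv by (auto simp: two_sided_invertible_def)
  have p: "star p * m = m * p" and q: "star (m * q) = m * q"
    using assms(1,2) by (simp_all add: weighted_selfadjoint_def star_mult sa)
  have "m * (q * p) = star (m * q * p)"
    using assms(3) by (simp add: weighted_selfadjoint_def mult.assoc)
  also have "\<dots> = star p * (m * q)"
    by (simp only: star_mult[of "m * q"] q)
  also have "\<dots> = m * (p * q)"
    using p by (simp add: mult.assoc[symmetric])
  finally have "n * m * (q * p) = n * m * (p * q)"
    by (simp only: mult.assoc)
  then show ?thesis by (simp add: n)
qed

lemma is_weighted_core_inverseD:
  assumes "is_weighted_core_inverse m c z"
  shows "c * z * c = c" "z * c * z = z" "z * c * c = c" "c * z * z = z"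
    "weighted_selfadjoint m (c * z)"
  using assms is_weighted_core_inverse_props[OF inv sa assms]
  by (simp_all add: is_weighted_core_inverse_def weighted_selfadjoint_def mult.assoc)

text \<open>
  The condition on left ideals may be replaced by self-adjointness of \<open>c z\<close>: taking adjoints
  exchanges \<open>c z\<close> with \<open>z\<^sup>* c\<^sup>*\<close>, so that \<open>z\<close> and \<open>c\<^sup>* m\<close> become left multiples of each other.
\<close>

lemma is_weighted_core_inverseI:
  assumes czc: "c * z * c = c" and zcz: "z * c * z = z"
    and h: "weighted_selfadjoint m (c * z)" and cu: "c = z * u" and zw: "z = c * w"
  shows "is_weighted_core_inverse m c z"
proof -
  obtain n where n: "n * m = 1"
    using inv by (auto simp: two_sided_invertible_def)
  have adj: "star z * star c * m = m * c * z"
    using h by (simp add: weighted_selfadjoint_def star_mult sa mult.assoc)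
  have "z = z * (n * m) * c * z"
    by (simp add: n zcz)
  also have "\<dots> = z * n * (m * c * z)"
    by (simp only: mult.assoc)
  also have "\<dots> = z * n * star z * (star c * m)"
    by (simp only: adj[symmetric]) (simp only: mult.assoc)
  finally have z: "z = z * n * star z * (star c * m)" .
  have "star c * m = star (c * z * c) * m"
    by (simp only: czc)
  also have "\<dots> = star c * (star z * star c * m)"
    by (simp add: star_mult mult.assoc)
  also have "\<dots> = star c * m * c * z"
    by (simp only: adj) (simp only: mult.assoc)
  finally have c: "star c * m = star c * m * c * z" .
  have "left_ideal_of z = left_ideal_of (star c * m)"
    unfolding left_ideal_of_def using z c by (metis mult.assoc)
  moreover have "right_ideal_of z = right_ideal_of c"
    unfolding right_ideal_of_eq_iff using cu zw by blast
  ultimately show ?thesis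
    using czc by (simp add: is_weighted_core_inverse_def)
qed

lemma is_weighted_core_inverse_iff:
  "is_weighted_core_inverse m c z \<longleftrightarrow>
     c \<in> weighted_core_invertibles m \<and> weighted_core_inverse m c = z"
proof -
  have *: "weighted_core_inverse m c = z" if "is_weighted_core_inverse m c z" for z
    unfolding weighted_core_inverse_def
    using that weighted_core_inverse_unique[OF inv sa] by (blast intro: the_equality)
  then show ?thesis
    unfolding weighted_core_invertibles_def by blast
qed

lemma right_ideal_of_square:
  assumes "is_weighted_core_inverse m c z"
  shows "right_ideal_of c = right_ideal_of (c ^ 2)"
proof -
  note C = is_weighted_core_inverseD[OF assms]
  have "c = c * (c * z * z) * c"
    by (simp only: C)
  then have "c = c ^ 2 * (z * z * c)"
    by (simp add: power2_eq_square mult.assoc)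
  moreover have "c ^ 2 = c * c"
    by (simp add: power2_eq_square)
  ultimately show ?thesis
    unfolding right_ideal_of_eq_iff by blast
qed

text \<open>
  For idempotents, \<open>p g = g\<close> says that the range of \<open>g\<close> lies in that of \<open>p\<close>; the conclusion is the
  weighted adjoint of this equation. Together they are the relation \<open>g \<le> p\<close> of projections.
\<close>

lemma weighted_selfadjoint_absorb:
  assumes "weighted_selfadjoint m p" "weighted_selfadjoint m g" "p * g = g"
  shows "g * p = g"
  using weighted_selfadjoint_commute[of g p] assms by simp

section \<open>Core inverses of both products\<close>

text \<open>
  Here \<open>q x\<close> vanishes off the range of \<open>f = a b y x\<close>, and \<open>x\<close> maps the range of \<open>f\<close> into the range
  of \<open>e = b a x y\<close>. As \<open>e \<le> q\<close>, this gives \<open>q x = x f = e x\<close>, and \<open>q p = e p = e\<close> follows.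
\<close>

lemma core_inverse_products_projection:
  assumes a: "is_weighted_core_inverse m a x" and b: "is_weighted_core_inverse m b y"
    and ba: "is_weighted_core_inverse m (b * a) (x * y)"
    and ab: "is_weighted_core_inverse m (a * b) (y * x)"
  shows "b * y * (a * x) = b * a * (x * y)"
proof -
  note A = is_weighted_core_inverseD[OF a] and B = is_weighted_core_inverseD[OF b]
    and BA = is_weighted_core_inverseD[OF ba] and AB = is_weighted_core_inverseD[OF ab]
  define p where "p = a * x"
  define q where "q = b * y"
  define e where "e = b * a * (x * y)"
  define f where "f = a * b * (y * x)"
  have sp: "weighted_selfadjoint m p" and sq: "weighted_selfadjoint m q"
    and se: "weighted_selfadjoint m e"
    using A B BA by (simp_all add: p_def q_def e_def)
  have "q * b = b" and "p * x = x"
    using A B by (simp_all add: p_def q_def)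
  have qe: "q * e = e"
    using \<open>q * b = b\<close> by (simp add: e_def mult.assoc[symmetric])
  have "e = x * (y * (b * a) * (b * a) * (x * y))"
    using BA(3) by (simp add: e_def mult.assoc[symmetric])
  then have pe: "p * e = e"
    using \<open>p * x = x\<close> by (metis mult.assoc)
  have eq: "e * q = e" and ep: "e * p = e"
    using weighted_selfadjoint_absorb sp sq se qe pe by blast+
  have "q * x * f = b * (y * x * (a * b) * (y * x))"
    by (simp add: q_def f_def mult.assoc)
  then have qxf: "q * x * f = q * x"
    using AB(2) by (simp add: q_def mult.assoc)
  have "x * f = x * y * (x * (a * b) * (a * b) * (y * x))"
    using AB(3) by (metis f_def mult.assoc)
  moreover have "e * (x * y) = x * y"
    using BA(4) by (simp add: e_def)
  ultimately have exf: "e * (x * f) = x * f"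
    by (metis mult.assoc)
  have "q * x = x * f"
    by (metis qxf exf qe mult.assoc)
  moreover have "e * x = x * f"
    by (metis qxf exf eq mult.assoc)
  ultimately have qx: "q * x = e * x"
    by simp
  have xap: "x * (a * p) = p"
    using A(3) by (simp add: p_def mult.assoc[symmetric])
  have "q * p = e"
    by (metis qx xap ep mult.assoc)
  then show ?thesis
    by (simp only: p_def q_def e_def)
qed

text \<open>As \<open>q p = e\<close> is self-adjoint, it equals \<open>p q\<close>, which is \<open>f\<close> by exchanging \<open>a\<close> and \<open>b\<close>.\<close>

lemma core_inverse_products_projections_eq:
  assumes a: "is_weighted_core_inverse m a x" and b: "is_weighted_core_inverse m b y"
    and ba: "is_weighted_core_inverse m (b * a) (x * y)"
    and ab: "is_weighted_core_inverse m (a * b) (y * x)"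
  shows "b * a * (x * y) = a * b * (y * x)"
proof -
  have e: "b * y * (a * x) = b * a * (x * y)"
    by (rule core_inverse_products_projection[OF a b ba ab])
  have f: "a * x * (b * y) = a * b * (y * x)"
    by (rule core_inverse_products_projection[OF b a ab ba])
  have "a * x * (b * y) = b * y * (a * x)"
    using weighted_selfadjoint_commute is_weighted_core_inverseD(5) a b ba e by metis
  then show ?thesis
    using e f by simp
qed

text \<open>
  The ranges of \<open>p y\<close> and \<open>a b\<close> coincide, since \<open>x y \<R> = b a \<R>\<close> and \<open>a b a b \<R> = a b \<R>\<close>; that of
  \<open>b p\<close> is the range of \<open>b a\<close>. So \<open>e = f\<close> is what makes \<open>p y \<R> = b p \<R>\<close>.
\<close>

lemma core_inverse_of_compression:
  assumes a: "is_weighted_core_inverse m a x" and b: "is_weighted_core_inverse m b y"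
    and ba: "is_weighted_core_inverse m (b * a) (x * y)"
    and ab: "is_weighted_core_inverse m (a * b) (y * x)"
  shows "is_weighted_core_inverse m (b * a * x) (a * x * y)"
proof -
  note A = is_weighted_core_inverseD[OF a] and B = is_weighted_core_inverseD[OF b]
    and BA = is_weighted_core_inverseD[OF ba] and AB = is_weighted_core_inverseD[OF ab]
  define e where "e = b * a * (x * y)"
  have ef: "e = a * b * (y * x)"
    unfolding e_def by (rule core_inverse_products_projections_eq[OF a b ba ab])
  have xax: "x * (a * (x * t)) = x * t" for t
    using A(2) by (metis mult.assoc)
  have cz: "b * a * x * (a * x * y) = e"
    by (simp add: e_def mult.assoc xax)
  show ?thesis
  proof (rule is_weighted_core_inverseI)
    have "e * (b * a) = b * a"
      using BA(1) by (simp add: e_def)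
    then have ec: "e * (b * a * x) = b * a * x"
      by (metis mult.assoc)
    then show "b * a * x * (a * x * y) * (b * a * x) = b * a * x"
      by (simp only: cz)
    have "x * y * e = x * y"
      using BA(2) by (simp add: e_def mult.assoc)
    then have "a * x * y * e = a * x * y"
      by (metis mult.assoc)
    then show "a * x * y * (b * a * x) * (a * x * y) = a * x * y"
      using cz by (simp add: mult.assoc)
    show "weighted_selfadjoint m (b * a * x * (a * x * y))"
      using BA(5) by (simp only: cz e_def)
    have "a * b = a * b * (a * b * (y * x) * (y * x)) * (a * b)"
      by (simp only: AB)
    then have "a * b = a * (b * a) * (b * (y * x) * (y * x) * (a * b))"
      by (simp add: mult.assoc)
    also have "b * a = x * y * (b * a) * (b * a)"
      by (simp only: BA(3))
    finally have "a * b = a * x * y * ((b * a) * (b * a) * (b * (y * x) * (y * x) * (a * b)))"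
      by (simp add: mult.assoc)
    then have "b * a * x
        = a * x * y * ((b * a) * (b * a) * (b * (y * x) * (y * x) * (a * b))) * (y * x) * (b * a * x)"
      using ec ef by metis
    then show "b * a * x
        = a * x * y * ((b * a) * (b * a) * (b * (y * x) * (y * x) * (a * b)) * (y * x) * (b * a * x))"
      by (simp only: mult.assoc)
    have "a * x * y = a * (b * a * (x * y) * (x * y))"
      by (simp only: BA(4)) (simp only: mult.assoc)
    then have pab: "a * x * y = a * b * (a * (x * y) * (x * y))"
      by (metis mult.assoc)
    have "e * (a * b) = a * b"
      using AB(1) by (simp add: ef)
    then have "a * x * y = e * (a * x * y)"
      using pab by (metis mult.assoc)
    then show "a * x * y = b * a * x * (a * x * y * (a * x * y))"
      using cz by (metis mult.assoc)
  qed
qed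

section \<open>Core inverses of both compressions\<close>

text \<open>
  The range of \<open>q x\<close> is that of \<open>f = a q x\<close>, so \<open>q x = f q x\<close>; and \<open>f \<le> q\<close> gives \<open>q x = f x\<close>.
  Then \<open>q p = f p = f\<close>, because \<open>f \<le> p\<close>.
\<close>

lemma core_inverse_compression_projection:
  assumes a: "is_weighted_core_inverse m a x" and b: "is_weighted_core_inverse m b y"
    and aq: "is_weighted_core_inverse m (a * b * y) (b * y * x)"
  shows "b * y * (a * x) = a * b * y * x"
proof -
  note A = is_weighted_core_inverseD[OF a] and B = is_weighted_core_inverseD[OF b]
    and AQ = is_weighted_core_inverseD[OF aq]
  define p where "p = a * x"
  define q where "q = b * y"
  define f where "f = a * b * y * x"
  have qq: "q * q = q" and qb: "q * b = b" and pa: "p * a = a"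
    using A B by (simp_all add: p_def q_def mult.assoc[symmetric])
  have cz: "a * b * y * (b * y * x) = f"
  proof -
    have "a * b * y * (b * y * x) = a * (q * q) * x"
      by (simp add: q_def mult.assoc)
    then show ?thesis
      by (simp only: qq) (simp add: q_def f_def mult.assoc)
  qed
  have sp: "weighted_selfadjoint m p" and sq: "weighted_selfadjoint m q"
    and sf: "weighted_selfadjoint m f"
    using A B AQ(5)[unfolded cz] by (simp_all add: p_def q_def)
  have pf: "p * f = f"
    using pa by (simp add: f_def mult.assoc[symmetric])
  have "f = b * y * x * (a * b * y) * (a * b * y) * (b * y * x)"
    by (simp only: AQ(3) cz)
  then have "f = b * (y * x * (a * b * y) * (a * b * y) * (b * y * x))"
    by (simp only: mult.assoc)
  then have qf: "q * f = f"
    using qb by (metis mult.assoc)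
  have fp: "f * p = f" and fq: "f * q = f"
    using weighted_selfadjoint_absorb sp sq sf pf qf by blast+
  have "f * (q * x) = q * x"
    using AQ(4) by (simp only: cz q_def)
  then have qx: "q * x = f * x"
    by (metis fq mult.assoc)
  have xap: "x * (a * p) = p"
    using A(3) by (simp add: p_def mult.assoc[symmetric])
  have "q * p = f"
    by (metis qx xap fp mult.assoc)
  then show ?thesis
    by (simp only: p_def q_def f_def)
qed

lemma core_inverse_compression_projections_eq:
  assumes a: "is_weighted_core_inverse m a x" and b: "is_weighted_core_inverse m b y"
    and aq: "is_weighted_core_inverse m (a * b * y) (b * y * x)"
    and bp: "is_weighted_core_inverse m (b * a * x) (a * x * y)"
  shows "a * x * (b * y) = b * a * x * y"
    and "b * y * (a * x) = b * a * x * y"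
    and "a * b * y * x = b * a * x * y"
proof -
  show e: "a * x * (b * y) = b * a * x * y"
    by (rule core_inverse_compression_projection[OF b a bp])
  have "b * a * x * (a * x * y) = b * (a * x * a) * x * y"
    by (simp only: mult.assoc)
  then have "b * a * x * (a * x * y) = b * a * x * y"
    by (simp only: is_weighted_core_inverseD(1)[OF a])
  then have "weighted_selfadjoint m (a * x * (b * y))"
    using is_weighted_core_inverseD(5)[OF bp] by (simp only: e)
  then show e': "b * y * (a * x) = b * a * x * y"
    using weighted_selfadjoint_commute is_weighted_core_inverseD(5) a b e by metis
  show "a * b * y * x = b * a * x * y"
    using core_inverse_compression_projection[OF a b aq] e' by simp
qed

text \<open>
  Both \<open>a\<close> and \<open>b\<close> map \<open>e\<R>\<close> into itself, as \<open>a e = a q p\<close> and \<open>b e = b p q\<close> with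
  \<open>a q \<R> = b p \<R> = e\<R>\<close>. Because \<open>e\<R> = a b \<R> = a b a b \<R>\<close>, the map \<open>a\<close> is onto \<open>e\<R>\<close>, say
  \<open>e = a e t\<close>. Since \<open>x a\<close> is the identity on \<open>a\<R> \<supseteq> e\<R>\<close>, it follows that \<open>x e = e t\<close> and
  \<open>e = x (a e)\<close>, so \<open>x\<close> maps \<open>e\<R>\<close> onto itself.
\<close>

lemma core_inverse_of_product:
  assumes a: "is_weighted_core_inverse m a x" and b: "is_weighted_core_inverse m b y"
    and aq: "is_weighted_core_inverse m (a * b * y) (b * y * x)"
    and bp: "is_weighted_core_inverse m (b * a * x) (a * x * y)"
    and sq: "right_ideal_of (a * b) = right_ideal_of ((a * b) ^ 2)"
  shows "is_weighted_core_inverse m (b * a) (x * y)"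
proof -
  note A = is_weighted_core_inverseD[OF a] and B = is_weighted_core_inverseD[OF b]
    and BP = is_weighted_core_inverseD[OF bp] and AQ = is_weighted_core_inverseD[OF aq]
    and E = core_inverse_compression_projections_eq[OF a b aq bp]
  define p where "p = a * x"
  define q where "q = b * y"
  define e where "e = b * a * x * y"
  have pq: "p * q = e" and qp: "q * p = e" and f: "a * b * y * x = e"
    using E by (simp_all add: p_def q_def e_def)
  have pa: "p * a = a" and qb: "q * b = b" and xp: "x * p = x"
    and pp: "p * p = p" and qq: "q * q = q" and xap: "x * a * p = p"
    using A B by (simp_all add: p_def q_def mult.assoc[symmetric])
  have c: "b * a * x = b * p" and z: "a * x * y = p * y"
    and c': "a * b * y = a * q" and z': "b * y * x = q * x"
    by (simp_all add: p_def q_def mult.assoc)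
  have eq: "e = b * p * y" and fq: "e = a * q * x"
    using f by (simp_all add: e_def p_def q_def mult.assoc)
  have cz: "b * p * (p * y) = e" and cz': "a * q * (q * x) = e"
    by (metis eq pp mult.assoc, metis fq qq mult.assoc)
  have ebp: "e * (b * p) = b * p" and epy: "e * (p * y) = p * y"
    and pye: "p * y * e = p * y"
    using BP(1,2,4) unfolding c z cz by (simp_all add: mult.assoc[symmetric] eq)
      (metis cz eq mult.assoc)
  have eaq: "e * (a * q) = a * q"
    using AQ(1) unfolding c' z' cz' .
  have eba: "e * (b * a) = b * a"
    by (metis ebp pa mult.assoc)
  have eab: "e * (a * b) = a * b"
    by (metis eaq qb mult.assoc)
  have eae: "e * (a * e) = a * e"
    by (metis eaq qp mult.assoc)
  have ebe: "e * (b * e) = b * e"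
    by (metis ebp pq mult.assoc)
  have xae: "x * (a * e) = e"
    by (metis xap pq mult.assoc)
  obtain u where u: "a * b = (a * b) ^ 2 * u"
    using sq unfolding right_ideal_of_eq_iff by blast
  have "e = a * b * (y * x)"
    using f by (simp add: mult.assoc)
  also have "\<dots> = a * b * (a * b) * u * (y * x)"
    using u by (simp add: power2_eq_square)
  also have "\<dots> = a * (b * (e * (a * b))) * u * (y * x)"
    by (simp only: eab) (simp only: mult.assoc)
  also have "\<dots> = a * (b * e) * (a * b * u * (y * x))"
    by (simp only: mult.assoc)
  also have "\<dots> = a * (e * (b * e)) * (a * b * u * (y * x))"
    by (simp only: ebe)
  finally obtain t where t: "e = a * (e * t)"
    by (metis mult.assoc)
  have xe: "x * e = e * t"
    by (metis t xae mult.assoc)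
  have xpy: "x * y = x * (p * y)"
    by (metis xp mult.assoc)
  have baxy: "b * a * (x * y) = e"
    by (simp add: e_def mult.assoc)
  show ?thesis
  proof (rule is_weighted_core_inverseI)
    show "b * a * (x * y) * (b * a) = b * a"
      by (simp only: baxy eba)
    show "x * y * (b * a) * (x * y) = x * y"
      by (metis xpy pye baxy mult.assoc)
    show "weighted_selfadjoint m (b * a * (x * y))"
      using BP(5) unfolding c z cz baxy .
    have "x * y = e * (t * (p * y))"
      by (metis xpy epy xe mult.assoc)
    then show "x * y = b * a * (x * y * (t * (p * y)))"
      using baxy by (metis mult.assoc)
    have "e = p * y * (b * p * (b * p) * y)"
      using BP(3) unfolding c z by (metis eq mult.assoc)
    then have "x * e = x * y * (b * p * (b * p) * y)"
      by (metis xpy mult.assoc)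
    moreover have "b * a = x * e * (a * e * (b * a))"
      by (metis xae eae eba mult.assoc)
    ultimately show "b * a = x * y * (b * p * (b * p) * y * (a * e * (b * a)))"
      by (simp only: mult.assoc)
  qed
qed

end

section \<open>The equivalence\<close>

theorem theorem4p12:
  fixes m a b :: "'a::involutive_ring"
  assumes "two_sided_invertible m" and "star m = m"
    and "a \<in> weighted_core_invertibles m" and "b \<in> weighted_core_invertibles m"
  shows
    "(a * b \<in> weighted_core_invertibles m \<and>
      b * a \<in> weighted_core_invertibles m \<and>
      weighted_core_inverse m (b * a) = weighted_core_inverse m a * weighted_core_inverse m b \<and>
      weighted_core_inverse m (a * b) = weighted_core_inverse m b * weighted_core_inverse m a)
     \<longleftrightarrow>
     (b * a * weighted_core_inverse m a \<in> weighted_core_invertibles m \<and>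
      a * b * weighted_core_inverse m b \<in> weighted_core_invertibles m \<and>
      weighted_core_inverse m (a * b * weighted_core_inverse m b)
        = b * weighted_core_inverse m b * weighted_core_inverse m a \<and>
      weighted_core_inverse m (b * a * weighted_core_inverse m a)
        = a * weighted_core_inverse m a * weighted_core_inverse m b \<and>
      right_ideal_of (b * a) = right_ideal_of ((b * a) ^ 2) \<and>
      right_ideal_of (a * b) = right_ideal_of ((a * b) ^ 2))"
    (is "?products \<longleftrightarrow> ?compressions")
proof -
  note m = assms(1,2)
  define x where "x = weighted_core_inverse m a"
  define y where "y = weighted_core_inverse m b"
  note core_iff = is_weighted_core_inverse_iff[OF m]
  have a: "is_weighted_core_inverse m a x" and b: "is_weighted_core_inverse m b y"
    using assms(3,4) by (simp_all add: core_iff x_def y_def)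
  have products: "?products \<longleftrightarrow>
      is_weighted_core_inverse m (b * a) (x * y) \<and> is_weighted_core_inverse m (a * b) (y * x)"
    unfolding core_iff x_def y_def by blast
  have compressions: "?compressions \<longleftrightarrow>
      is_weighted_core_inverse m (b * a * x) (a * x * y) \<and>
      is_weighted_core_inverse m (a * b * y) (b * y * x) \<and>
      right_ideal_of (b * a) = right_ideal_of ((b * a) ^ 2) \<and>
      right_ideal_of (a * b) = right_ideal_of ((a * b) ^ 2)"
    unfolding core_iff x_def y_def by blast
  show ?thesis
    unfolding products compressions
    using core_inverse_of_compression[OF m a b] core_inverse_of_compression[OF m b a]
      core_inverse_of_product[OF m a b] core_inverse_of_product[OF m b a]
      right_ideal_of_square[OF m]
    by blast
qed

end
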